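(* Let $r\geqslant 2$, $\ell\geqslant 1$ with $\gcd(r,\ell)\in\{1,2\}$, and set $m=2^r(2^\ell+1)$, $d=(m-2)/2$, $e=\binom{(d-1)/2}{2}$. For every $n\geqslant 1$ and every $f=\sum_{k=0}^{m}a_{m-k}x^k\in\mathbb F_{2^n}[x]$ with $a_0\neq 0$ and $a_1\neq 0$, the number of $\alpha\in\overline{\mathbb F}_2^*$ such that $L_\alpha f$ does not have distinct critical values (i.e. $\Pi_d(L_\alpha f)=0$) is at most $(5d+4)e$.
   Context: For $m\equiv 0\pmod 4$, $d=(m-2)/2$, $f$ of degree at most $m$ and $\alpha\neq 0$, $L_\alpha f$ is the unique polynomial of degree at most $d$ such that $(L_\alpha f)(x(x+\alpha))=f(x+\alpha)+f(x)$; when $a_1\neq 0$ it has degree exactly $d$ with leading coefficient $b_0=a_1\alpha$. For $d$ odd and $g=\sum_{k=0}^{d}b_{d-k}x^k$ of degree $d$ in characteristic 2, write $g'=b_0\prod_{i=1}^{(d-1)/2}(x+\tau_i)^2$ and $\Pi_d(g)=\prod_{i\neq j}(g(\tau_i)-g(\tau_j))$; $g$ has distinct critical values iff $\Pi_d(g)\neq 0$ (distinct roots of $g'$ give distinct values of $g$). *)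

theory Defs
  imports "HOL-Computational_Algebra.Polynomial"
begin

text \<open>A field K is (a copy of) the algebraic closure of F_2: characteristic 2,
  algebraically closed, and every element is algebraic over F_2, i.e. lies in
  some finite subfield F_{2^k} = {x. x^(2^k) = x}, k \<ge> 1.\<close>
definition is_alg_closure_F2 :: "'a::field itself \<Rightarrow> bool" where
  "is_alg_closure_F2 _ \<longleftrightarrow>
     CHAR('a) = 2
     \<and> (\<forall>p :: 'a poly. degree p > 0 \<longrightarrow> (\<exists>x. poly p x = 0))
     \<and> (\<forall>x :: 'a. \<exists>k>0. x ^ (2 ^ k) = x)"

definition subfield_F2n :: "nat \<Rightarrow> 'a::field set" where
  "subfield_F2n n = {x. x ^ (2 ^ n) = x}"

definition L_op :: "nat \<Rightarrow> 'a::field \<Rightarrow> 'a poly \<Rightarrow> 'a poly" where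
  "L_op d \<alpha> f = (THE g. degree g \<le> d \<and>
      pcompose g [:0, \<alpha>, 1:] = pcompose f [:\<alpha>, 1:] + f)"

definition Pi_d :: "nat \<Rightarrow> 'a::field poly \<Rightarrow> 'a" where
  "Pi_d d g = (let ts = (SOME ts :: 'a list. length ts = (d - 1) div 2 \<and>
        pderiv g = smult (coeff g d) (\<Prod>t\<leftarrow>ts. [:t, 1:] ^ 2))
     in \<Prod>i<length ts. \<Prod>j<length ts.
          if i \<noteq> j then poly g (ts ! i) - poly g (ts ! j) else 1)"

end

theory Submission
  imports Defs "Jordan_Normal_Form.Determinant" "HOL-Computational_Algebra.Primes"
begin

text \<open>
  Put \<open>b = 1 / \<alpha>\<close> and substitute \<open>y = \<alpha>\<^sup>2 z\<close>: up to a scalar, \<open>L\<^sub>\<alpha> f\<close> becomes a polynomial \<open>G\<^sub>b(z)\<close>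
  whose coefficients are polynomials in \<open>b\<close>, so \<open>\<alpha> = \<infinity>\<close> can be reached by setting \<open>b = 0\<close>.
  In the variable \<open>w = z\<^sup>2\<close> the derivative of \<open>G\<^sub>b\<close> is a multiple of a monic polynomial \<open>H\<close> of degree
  \<open>N = (d - 1) / 2\<close> and \<open>G\<^sub>b\<^sup>2\<close> is a polynomial \<open>u\<close> with \<open>u' = (a\<^sub>1 b H)\<^sup>2\<close>. Write the powers
  \<open>u\<^sup>0, \<dots>, u\<^sup>N\<^sup>-\<^sup>1\<close> modulo \<open>H\<close> in the basis \<open>1, w, \<dots>, w\<^sup>N\<^sup>-\<^sup>1\<close>. The determinant of the resulting matrix is
  a polynomial in \<open>b\<close> that vanishes whenever two critical values coincide, and giving \<open>w\<close> weight 4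
  bounds its degree by \<open>(4 d + 2) e\<close>.

  The determinant is nonzero at \<open>b = 0\<close>: there the critical points are \<open>x\<^sup>2 + x\<close> with
  \<open>x\<^sup>d = (x + 1)\<^sup>d\<close>, with values proportional to \<open>x\<^sup>m + (x + 1)\<^sup>m\<close>. If two of these values agree, the two \<open>x\<close>
  differ by an element of the field with \<open>2\<^sup>l\<close> elements; combining this with the two critical equations
  shows that the points agree, or that both \<open>x\<close> are fixed by the \<open>r\<close>-th and \<open>l\<close>-th powers of Frobenius and
  so lie in the field with four elements, where \<open>x\<^sup>2 + x = 1\<close>.
\<close>

section \<open>Coincidences of values at the roots of a monic family\<close>

text \<open>The parameter \<open>b\<close> has weight 1 and the outer variable weight
  \<open>c\<close>. Zero coefficients are excluded, since \<open>degree 0 = 0\<close> would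
  otherwise force \<open>c * i \<le> D\<close> for every \<open>i\<close>.\<close>

definition weight_le :: "nat \<Rightarrow> nat \<Rightarrow> 'a::comm_ring_1 poly poly \<Rightarrow> bool" where
  "weight_le c D p \<longleftrightarrow> (\<forall>i. coeff p i \<noteq> 0 \<longrightarrow> degree (coeff p i) + c * i \<le> D)"

definition eval2 :: "'a::comm_ring_1 poly poly \<Rightarrow> 'a \<Rightarrow> 'a \<Rightarrow> 'a" where
  "eval2 p w b = poly (poly p [:w:]) b"

lemma eval2_simps [simp]:
  "eval2 (p + q) w b = eval2 p w b + eval2 q w b"
  "eval2 (p * q) w b = eval2 p w b * eval2 q w b"
  "eval2 (p ^ n) w b = eval2 p w b ^ n"
  "eval2 (Polynomial.smult a p) w b = poly a b * eval2 p w b"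
  "eval2 0 w b = 0" "eval2 1 w b = 1"
  by (simp_all add: eval2_def)

lemma eval2_monom [simp]: "eval2 (monom a i) w b = poly a b * w ^ i"
  by (simp add: eval2_def poly_monom)

lemma eval2_sum [simp]: "eval2 (\<Sum>i\<in>I. p i) w b = (\<Sum>i\<in>I. eval2 (p i) w b)"
  by (induction I rule: infinite_finite_induct) auto

lemma poly_as_sum_of_monoms_less:
  assumes "\<forall>i\<ge>N. coeff p i = 0"
  shows "p = (\<Sum>i<N. monom (coeff p i) i)"
proof (rule poly_eqI)
  fix n show "coeff p n = coeff (\<Sum>i<N. monom (coeff p i) i) n"
    using assms by (cases "n < N") (auto simp: coeff_sum if_distrib cong: if_cong)
qed

lemma eval2_conv_sum:
  assumes "\<forall>i\<ge>N. coeff p i = 0"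
  shows "eval2 p w b = (\<Sum>i<N. poly (coeff p i) b * w ^ i)"
  by (subst poly_as_sum_of_monoms_less[OF assms]) simp

lemma pderiv_sum_poly: "pderiv (\<Sum>i\<in>I. p i) = (\<Sum>i\<in>I. pderiv (p i))"
  by (induction I rule: infinite_finite_induct) (auto simp: pderiv_add)

lemma eval2_pderiv_conv_sum:
  fixes p :: "'a::idom poly poly"
  assumes "\<forall>i\<ge>N. coeff p i = 0"
  shows "eval2 (pderiv p) w b = (\<Sum>i<N. poly (coeff p i) b * (of_nat i * w ^ (i - 1)))"
  by (subst poly_as_sum_of_monoms_less[OF assms])
     (simp add: pderiv_sum_poly pderiv_monom mult_ac flip: of_nat_poly)

lemma weight_le_mono: "weight_le c D p \<Longrightarrow> D \<le> D' \<Longrightarrow> weight_le c D' p"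
  by (force simp: weight_le_def)

lemma weight_le_add:
  assumes "weight_le c D p" "weight_le c D q"
  shows "weight_le c D (p + q)"
  unfolding weight_le_def
proof (intro allI impI)
  fix i assume nz: "coeff (p + q) i \<noteq> 0"
  show "degree (coeff (p + q) i) + c * i \<le> D"
  proof (cases "coeff p i = 0 \<or> coeff q i = 0")
    case True
    then show ?thesis using assms nz by (auto simp: weight_le_def)
  next
    case False
    then show ?thesis
      using assms degree_add_le_max[of "coeff p i" "coeff q i"]
      by (force simp: weight_le_def)
  qed
qed

lemma weight_le_uminus: "weight_le c D p \<Longrightarrow> weight_le c D (- p)"
  by (simp add: weight_le_def)

lemma weight_le_0 [simp]: "weight_le c D 0"
  by (simp add: weight_le_def)

lemma weight_le_sum: "(\<And>i. i \<in> I \<Longrightarrow> weight_le c D (p i)) \<Longrightarrow> weight_le c D (\<Sum>i\<in>I. p i)"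
  by (induction I rule: infinite_finite_induct) (auto intro: weight_le_add)

lemma weight_le_monom:
  assumes "a \<noteq> 0 \<Longrightarrow> degree a + c * i \<le> D"
  shows "weight_le c D (monom a i)"
  using assms by (simp add: weight_le_def)

lemma weight_le_mult:
  fixes p q :: "'a::idom poly poly"
  assumes "weight_le c D p" "weight_le c D' q"
  shows "weight_le c (D + D') (p * q)"
proof -
  have "p * q = (\<Sum>i\<le>degree p. \<Sum>j\<le>degree q. monom (coeff p i * coeff q j) (i + j))"
    by (subst (1 2) poly_as_sum_of_monoms[symmetric])
       (simp add: sum_product mult_monom)
  moreover have "weight_le c (D + D') (monom (coeff p i * coeff q j) (i + j))" for i j
  proof (rule weight_le_monom)
    assume "coeff p i * coeff q j \<noteq> 0"
    then have "degree (coeff p i) + c * i \<le> D" "degree (coeff q j) + c * j \<le> D'"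
      using assms by (auto simp: weight_le_def)
    then show "degree (coeff p i * coeff q j) + c * (i + j) \<le> D + D'"
      using degree_mult_le[of "coeff p i" "coeff q j"] by (simp add: algebra_simps)
  qed
  ultimately show ?thesis by (auto intro!: weight_le_sum)
qed

lemma weight_le_power:
  fixes p :: "'a::idom poly poly"
  assumes "weight_le c D p"
  shows "weight_le c (k * D) (p ^ k)"
proof (induction k)
  case 0
  then show ?case by (auto simp: weight_le_def)
next
  case (Suc k)
  then show ?case using weight_le_mult[OF assms, of "k * D" "p ^ k"] by simp
qed

text \<open>The leading monomial of \<open>H\<close> carries the full weight \<open>c * N\<close>.
  Cancelling a top coefficient with a multiple of \<open>H\<close> thus introduces nothing heavier
  than the cancelled monomial, so reduction modulo \<open>H\<close> costs no weight.\<close>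

lemma weighted_monic_division:
  fixes H p :: "'a::idom poly poly"
  assumes H: "coeff H N = 1" "degree H \<le> N" "weight_le c (c * N) H"
    and p: "weight_le c D p"
  shows "\<exists>q R. p = q * H + R \<and> (\<forall>i\<ge>N. coeff R i = 0) \<and> weight_le c D R"
proof -
  have "\<exists>q R. p = q * H + R \<and> (\<forall>i\<ge>N. coeff R i = 0) \<and> weight_le c D R"
    if "\<forall>i\<ge>N + n. coeff p i = 0" "weight_le c D p" for n p
    using that
  proof (induction n arbitrary: p)
    case 0
    then show ?case by (intro exI[of _ 0] exI[of _ p]) auto
  next
    case (Suc n)
    define a where "a = coeff p (N + n)"
    define p1 where "p1 = p + - (monom a n * H)"
    have "coeff p1 i = 0" if "i \<ge> N + n" for i
    proof (cases "i = N + n")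
      case True
      then show ?thesis
        using H by (simp add: p1_def a_def coeff_monom_mult)
    next
      case False
      with that have "i \<ge> N + Suc n" "i - n > N" by auto
      then show ?thesis
        using Suc.prems(1) H(2) by (simp add: p1_def coeff_monom_mult coeff_eq_0)
    qed
    moreover have "weight_le c D p1"
    proof (cases "a = 0")
      case True
      then show ?thesis using Suc.prems by (simp add: p1_def)
    next
      case False
      then have "degree a + c * (N + n) \<le> D"
        using Suc.prems by (auto simp: weight_le_def a_def)
      moreover have "weight_le c ((degree a + c * n) + c * N) (monom a n * H)"
        by (intro weight_le_mult H weight_le_monom) auto
      ultimately have "weight_le c D (monom a n * H)"
        by (elim weight_le_mono) (simp add: algebra_simps)
      then show ?thesis
        unfolding p1_def by (intro weight_le_add weight_le_uminus Suc.prems)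
    qed
    ultimately obtain q R where "p1 = q * H + R" "\<forall>i\<ge>N. coeff R i = 0" "weight_le c D R"
      using Suc.IH by blast
    then show ?case
      by (intro exI[of _ "q + monom a n"] exI[of _ R])
         (simp add: p1_def algebra_simps eq_neg_iff_add_eq_0)
  qed
  from this[where n = "Suc (degree p)" and p = p] p show ?thesis
    by (simp add: coeff_eq_0)
qed

section \<open>Determinants with polynomial entries\<close>

lemma poly_det:
  "poly (det A) b = det (map_mat (\<lambda>p. poly p b) A)"
proof -
  interpret comm_ring_hom "\<lambda>p. poly p b" by unfold_locales auto
  show ?thesis by simp
qed

text \<open>Each Leibniz term takes one entry from every row, so the row bounds add up.\<close>

lemma degree_det_le:
  fixes A :: "'a::idom poly mat"
  assumes "A \<in> carrier_mat n n"
    and "\<And>i j. i < n \<Longrightarrow> j < n \<Longrightarrow> degree (A $$ (i, j)) \<le> f i"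
  shows "degree (det A) \<le> (\<Sum>i<n. f i)"
  unfolding det_def'[OF assms(1)]
proof (rule degree_sum_le)
  show "finite {p. p permutes {0..<n}}" by (simp add: finite_permutations)
  fix p assume "p \<in> {p. p permutes {0..<n}}"
  then have p: "p permutes {0..<n}" by simp
  have "degree (\<Prod>i = 0..<n. A $$ (i, p i)) \<le> (\<Sum>i = 0..<n. degree (A $$ (i, p i)))"
    by (rule order.trans[OF degree_prod_sum_le]) auto
  also have "\<dots> \<le> (\<Sum>i = 0..<n. f i)"
    using permutes_in_image[OF p] by (intro sum_mono assms(2)) auto
  finally show "degree (signof p * (\<Prod>i = 0..<n. A $$ (i, p i))) \<le> (\<Sum>i<n. f i)"
    by (simp add: sign_def atLeast0LessThan)
qed

lemma poly_eq_0_if_many_roots: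
  fixes p :: "'a::idom poly"
  assumes "\<forall>i\<ge>N. coeff p i = 0" "card V \<ge> N" "finite V" "\<forall>v\<in>V. poly p v = 0"
  shows "p = 0"
proof (rule ccontr)
  assume nz: "p \<noteq> 0"
  then have "degree p < N"
    using assms(1) leading_coeff_neq_0 not_less by blast
  moreover have "card V \<le> card {x. poly p x = 0}"
    using assms nz by (intro card_mono poly_roots_finite) auto
  ultimately show False using card_poly_roots_bound[OF nz] assms(2) by simp
qed

text \<open>The polynomial \<open>P\<close> is the determinant of the matrix of \<open>u ^ k mod H\<close> for \<open>k < N\<close>.
  It is singular at \<open>b\<close> when two roots \<open>w, w'\<close> have the same value, with null vector \<open>(w ^ l - w' ^ l)\<close>, and
  when \<open>w\<close> is a double root with \<open>u' w = 0\<close>, with null vector \<open>(l * w ^ (l - 1))\<close>.\<close>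
lemma coincidence_polynomial:
  fixes H u :: "'a::field poly poly"
  assumes H: "coeff H N = 1" "degree H \<le> N" "weight_le c (c * N) H"
    and u: "weight_le c D u" and N: "N \<ge> 2"
    and W: "finite W" "\<And>w. w \<in> W \<Longrightarrow> eval2 H w 0 = 0" "card ((\<lambda>w. eval2 u w 0) ` W) \<ge> N"
  obtains P where "P \<noteq> 0" "degree P \<le> D * (N choose 2)"
    "\<And>b w w'. eval2 H w b = 0 \<Longrightarrow> eval2 H w' b = 0 \<Longrightarrow> w \<noteq> w' \<Longrightarrow>
        eval2 u w b = eval2 u w' b \<Longrightarrow> poly P b = 0"
    "\<And>b w. eval2 H w b = 0 \<Longrightarrow> eval2 (pderiv H) w b = 0 \<Longrightarrow> eval2 (pderiv u) w b = 0 \<Longrightarrow>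
        poly P b = 0"
proof -
  have "\<forall>k. \<exists>q R. u ^ k = q * H + R \<and> (\<forall>i\<ge>N. coeff R i = 0) \<and> weight_le c (k * D) R"
    using weighted_monic_division[OF H weight_le_power[OF u]] by blast
  then obtain Q R where QR: "\<And>k. u ^ k = Q k * H + R k"
    and R: "\<And>k. \<forall>i\<ge>N. coeff (R k) i = 0" and wR: "\<And>k. weight_le c (k * D) (R k)"
    by metis
  define A where "A = mat N N (\<lambda>(k, l). coeff (R k) l)"
  have A: "A \<in> carrier_mat N N" by (simp add: A_def)
  define B where "B b = map_mat (\<lambda>p. poly p b) A" for b
  have B: "B b \<in> carrier_mat N N" for b using A by (simp add: B_def)
  have B_entry: "B b $$ (k, l) = poly (coeff (R k) l) b" if "k < N" "l < N" for b k l
    using that by (simp add: B_def A_def)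
  \<comment> \<open>Both null vectors used below vanish at index 0, so nontriviality is read off at
    index 1, which exists because \<open>N \<ge> 2\<close>.\<close>
  have singular: "poly (det A) b = 0"
    if "v 1 \<noteq> 0" "\<And>k. k < N \<Longrightarrow> (\<Sum>l<N. poly (coeff (R k) l) b * v l) = 0" for b and v :: "nat \<Rightarrow> 'a"
  proof -
    have "vec N v \<noteq> 0\<^sub>v N"
      using that(1) N by (auto dest: arg_cong[where f = "\<lambda>x. x $ 1"])
    moreover have "B b *\<^sub>v vec N v = 0\<^sub>v N"
    proof (rule eq_vecI)
      fix k assume "k < dim_vec (0\<^sub>v N :: 'a vec)"
      then have k: "k < N" by simp
      have "(B b *\<^sub>v vec N v) $ k = (\<Sum>l<N. B b $$ (k, l) * v l)"
        using k B[of b] by (auto simp: scalar_prod_def atLeast0LessThan intro!: sum.cong)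
      also have "\<dots> = 0" using that(2)[OF k] k by (simp add: B_entry)
      finally show "(B b *\<^sub>v vec N v) $ k = 0\<^sub>v N $ k" using k by simp
    qed (use B[of b] in auto)
    ultimately have "det (B b) = 0"
      using det_0_iff_vec_prod_zero_field[OF B[of b]] vec_carrier by blast
    then show ?thesis by (simp add: poly_det B_def)
  qed
  show thesis
  proof (rule that[of "det A"])
    \<comment> \<open>A relation among the rows of \<open>B 0\<close> is a polynomial
      \<open>C\<close> of degree below \<open>N\<close> with \<open>C(u)\<close> divisible by
      \<open>H\<close> at \<open>b = 0\<close>. It vanishes at the values of \<open>u\<close> on
      \<open>W\<close>, of which at least \<open>N\<close> are distinct, so it is zero.\<close>
    have "det (B 0) \<noteq> 0"
    proof
      assume "det (B 0) = 0"
      then have "det (transpose_mat (B 0)) = 0" using det_transpose[OF B] by simp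
      then obtain x where x: "x \<in> carrier_vec N" "x \<noteq> 0\<^sub>v N" "transpose_mat (B 0) *\<^sub>v x = 0\<^sub>v N"
        using det_0_iff_vec_prod_zero_field[of "transpose_mat (B 0)" N] B[of 0] by auto
      have col: "(\<Sum>k<N. poly (coeff (R k) l) 0 * x $ k) = 0" if l: "l < N" for l
      proof -
        have "0 = (transpose_mat (B 0) *\<^sub>v x) $ l" using x(3) l by simp
        also have "\<dots> = (\<Sum>k<N. B 0 $$ (k, l) * x $ k)"
          using l B[of 0] x(1) by (auto simp: scalar_prod_def atLeast0LessThan intro!: sum.cong)
        finally show ?thesis using l by (simp add: B_entry)
      qed
      define C where "C = (\<Sum>k<N. monom (x $ k) k)"
      have coeff_C: "coeff C k = (if k < N then x $ k else 0)" for k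
        by (auto simp: C_def coeff_sum if_distrib cong: if_cong)
      have "C = 0"
      proof (rule poly_eq_0_if_many_roots)
        show "\<forall>v\<in>(\<lambda>w. eval2 u w 0) ` W. poly C v = 0"
        proof safe
          fix w assume w: "w \<in> W"
          have "poly C (eval2 u w 0) = (\<Sum>k<N. x $ k * eval2 (u ^ k) w 0)"
            by (simp add: C_def poly_sum poly_monom)
          also have "\<dots> = (\<Sum>k<N. x $ k * eval2 (R k) w 0)"
            using W(2)[OF w] by (subst QR) simp
          also have "\<dots> = (\<Sum>k<N. \<Sum>l<N. x $ k * (poly (coeff (R k) l) 0 * w ^ l))"
            by (simp add: eval2_conv_sum[OF R] sum_distrib_left)
          also have "\<dots> = (\<Sum>l<N. w ^ l * (\<Sum>k<N. poly (coeff (R k) l) 0 * x $ k))"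
            by (subst sum.swap) (simp add: sum_distrib_left mult_ac)
          also have "\<dots> = 0" by (simp add: col)
          finally show "poly C (eval2 u w 0) = 0" .
        qed
      qed (use W coeff_C in auto)
      then have "x $ k = 0" if "k < N" for k
        using coeff_C[of k] that by simp
      with x(1,2) show False by (auto intro!: eq_vecI)
    qed
    then show "det A \<noteq> 0" using poly_det[of A 0] by (auto simp: B_def)
    have "degree (det A) \<le> (\<Sum>k<N. k * D)"
    proof (rule degree_det_le[OF A])
      fix k l assume "k < N" "l < N"
      then show "degree (A $$ (k, l)) \<le> k * D"
        using wR[of k] by (cases "coeff (R k) l = 0") (auto simp: A_def weight_le_def)
    qed
    also have "(\<Sum>k<N. k * D) = D * (\<Sum>k<N. k)"
      by (simp add: sum_distrib_left mult.commute)
    also have "(\<Sum>k<N. k) = N choose 2"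
      using gauss_sum_nat[of "N - 1"] N
      by (cases N) (simp_all add: choose_two lessThan_Suc_atMost atMost_atLeast0)
    finally show "degree (det A) \<le> D * (N choose 2)" .
  next
    fix b w w' assume w: "eval2 H w b = 0" "eval2 H w' b = 0" "w \<noteq> w'" "eval2 u w b = eval2 u w' b"
    show "poly (det A) b = 0"
    proof (rule singular[where v = "\<lambda>l. w ^ l - w' ^ l"])
      fix k
      have "eval2 (u ^ k) w b = eval2 (u ^ k) w' b" using w(4) by simp
      then have "eval2 (R k) w b - eval2 (R k) w' b = 0"
        using w(1,2) unfolding QR by simp
      then show "(\<Sum>l<N. poly (coeff (R k) l) b * (w ^ l - w' ^ l)) = 0"
        by (simp add: eval2_conv_sum[OF R] right_diff_distrib sum_subtractf)
    qed (use w in auto)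
  next
    fix b w assume w: "eval2 H w b = 0" "eval2 (pderiv H) w b = 0" "eval2 (pderiv u) w b = 0"
    show "poly (det A) b = 0"
    proof (rule singular[where v = "\<lambda>l. of_nat l * w ^ (l - 1)"])
      fix k
      have "eval2 (pderiv (u ^ k)) w b = 0"
        using w(3) by (cases k) (simp_all add: pderiv_power_Suc del: power_Suc)
      \<comment> \<open>At a double root of \<open>H\<close> the product rule kills the derivative
        of \<open>Q k * H\<close>, so the remainder inherits the vanishing derivative of
        \<open>u ^ k\<close>.\<close>
      then have "eval2 (pderiv (R k)) w b = 0"
        using w(1,2) unfolding QR by (simp add: pderiv_add pderiv_mult)
      then show "(\<Sum>l<N. poly (coeff (R k) l) b * (of_nat l * w ^ (l - 1))) = 0"
        by (simp add: eval2_pderiv_conv_sum[OF R])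
    qed auto
  qed
qed

section \<open>Frobenius and the critical points at infinity\<close>

lemma frobenius_add:
  assumes "CHAR('a::field) = 2"
  shows "(x + y :: 'a) ^ 2 ^ k = x ^ 2 ^ k + y ^ 2 ^ k"
  using freshmans_dream'[where 'a = 'a, of "2 ^ k" k x y] assms by simp

lemma char_2_add_self:
  assumes "CHAR('a::comm_ring_1) = 2"
  shows "x + x = (0 :: 'a)"
proof -
  have "of_nat 2 = (0 :: 'a)" using of_nat_CHAR[where 'a = 'a] by (simp only: assms)
  then have "(1 + 1) * x = 0" by simp
  then show ?thesis by (simp only: distrib_right mult_1)
qed

lemma char_2_add_eq_0_iff:
  assumes "CHAR('a::comm_ring_1) = 2"
  shows "x + y = 0 \<longleftrightarrow> x = (y :: 'a)"
  by (metis assms char_2_add_self add_left_imp_eq)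

lemma frobenius_inj:
  assumes "CHAR('a::field) = 2" "(x :: 'a) ^ 2 ^ k = y ^ 2 ^ k"
  shows "x = y"
proof -
  have "(x + y) ^ 2 ^ k = 0"
    by (simp only: frobenius_add[OF assms(1)] assms(2) char_2_add_self[OF assms(1)])
  then show ?thesis by (simp add: char_2_add_eq_0_iff assms(1))
qed

lemma frobenius_fixed_mult:
  assumes "(x :: 'a::monoid_mult) ^ 2 ^ n = x"
  shows "x ^ 2 ^ (n * k) = x"
  by (induction k) (simp_all add: assms power_add power_mult)

text \<open>Euclid's algorithm on the exponents of Frobenius: being fixed by the \<open>n\<close>-th
  power allows \<open>m\<close> to be replaced by \<open>m mod n\<close>.\<close>

lemma frobenius_fixed_gcd:
  assumes "(x :: 'a::monoid_mult) ^ 2 ^ m = x" "x ^ 2 ^ n = x"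
  shows "x ^ 2 ^ gcd m n = x"
  using assms
proof (induction m n rule: gcd_nat_induct)
  case (step m n)
  have "x ^ 2 ^ m = (x ^ 2 ^ (n * (m div n))) ^ 2 ^ (m mod n)"
    by (simp flip: power_mult power_add)
  then have "x ^ 2 ^ (m mod n) = x"
    using step.prems by (simp add: frobenius_fixed_mult)
  then show ?case using step by (simp add: gcd_red_nat[of m n])
qed simp

text \<open>Multiplying the hypothesis by \<open>x * (x + 1)\<close> raises the exponent to
  \<open>d + 1\<close>, where powers split into products of Frobenius images, which are
  additive.\<close>

lemma critical_equation:
  fixes x :: "'a::field"
  assumes char2: "CHAR('a) = 2" and d: "d + 1 = 2 ^ k * (2 ^ l + 1)" and x: "x ^ d = (x + 1) ^ d"
  shows "(x ^ 2 ^ k) ^ 2 ^ l * x ^ 2 ^ k = x * ((x ^ 2 ^ k) ^ 2 ^ l + x ^ 2 ^ k + 1)"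
proof -
  have pow: "z ^ (d + 1) = (z ^ 2 ^ k) ^ 2 ^ l * z ^ 2 ^ k" for z :: 'a
    by (simp only: d power_mult power_add power_one_right)
  have "(x + 1) * x ^ (d + 1) = x * (x + 1) ^ (d + 1)"
    using x by (simp add: algebra_simps)
  moreover define X Z where "X = x ^ 2 ^ k" and "Z = X ^ 2 ^ l"
  ultimately have "(x + 1) * (Z * X) = x * ((Z + 1) * (X + 1))"
    unfolding pow by (simp add: frobenius_add[OF char2])
  then have "Z * X = x * (Z + X + 1)" by (simp add: algebra_simps)
  then show ?thesis by (simp only: X_def Z_def)
qed

text \<open>The two alternatives are the points with the same \<open>x * (x + 1)\<close>. With
  \<open>w = x + y\<close>, equal values give \<open>w ^ 2 ^ l = w\<close>. Comparing the critical
  equations of \<open>x\<close> and \<open>y\<close> then leaves two cases: \<open>w\<close> is 0 or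
  1, or both points lie in F_4 away from 0 and 1 and are roots of
  \<open>z * z + z + 1\<close>.\<close>

lemma critical_points_separated:
  fixes x y :: "'a::field"
  assumes char2: "CHAR('a) = 2" and r: "r \<ge> 2" and g: "gcd r l \<in> {1, 2}"
    and m: "m = 2 ^ r * (2 ^ l + 1)" and d: "d = (m - 2) div 2"
    and x: "x ^ d = (x + 1) ^ d" and y: "y ^ d = (y + 1) ^ d"
    and xy: "x ^ m + (x + 1) ^ m = y ^ m + (y + 1) ^ m"
  shows "y = x \<or> y = x + 1"
proof -
  note two = char_2_add_self[OF char2]
  note add_eq_0 = char_2_add_eq_0_iff[OF char2]
  note frob = frobenius_add[OF char2]
  note frob_inj = frobenius_inj[OF char2]
  obtain k where k: "r = Suc k" "k \<ge> 1" using r by (cases r) auto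
  have "2 ^ k * (2 ^ l + 1 :: nat) \<ge> 2 ^ 1 * (2 ^ 0 + 1)"
    using k(2) by (intro mult_mono add_mono power_increasing) auto
  then have d': "d + 1 = 2 ^ k * (2 ^ l + 1)" and "d > 0"
    using d m k(1) by auto
  have neq: "z \<noteq> 0 \<and> z \<noteq> 1" if "z ^ d = (z + 1) ^ d" for z :: 'a
    using that two[of 1] \<open>d > 0\<close> by (auto simp: power_0_left)
  define q Q :: nat where "q = 2 ^ l" and "Q = 2 ^ k"
  note frobs = frob[of _ _ l, folded q_def] frob[of _ _ k, folded Q_def]
  have swap: "(z ^ q) ^ Q = (z ^ Q) ^ q" for z :: 'a
    by (simp add: mult.commute flip: power_mult)
  define w where "w = x + y"
  have y_eq: "y = x + w" using two[of x] by (simp add: w_def add.assoc[symmetric])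
  \<comment> \<open>Frobenius takes out the factor \<open>2 ^ r\<close> of \<open>m\<close>; in the
    remaining exponent \<open>q + 1\<close> the terms \<open>z * z ^ q\<close> cancel.\<close>
  have val: "z ^ m + (z + 1) ^ m = (z ^ q + z + 1) ^ 2 ^ r" for z :: 'a
  proof -
    have "z ^ m + (z + 1) ^ m = (z ^ (q + 1) + (z + 1) ^ (q + 1)) ^ 2 ^ r"
      unfolding frob m q_def by (simp only: mult.commute[of "2 ^ r"] power_mult)
    also have "z ^ (q + 1) + (z + 1) ^ (q + 1) = z ^ q + z + 1 + (z * z ^ q + z * z ^ q)"
      by (simp add: frobs algebra_simps)
    also have "\<dots> = z ^ q + z + 1" by (simp only: two add_0_right)
    finally show ?thesis .
  qed
  have "x ^ q + x + 1 = y ^ q + y + 1"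
    using xy unfolding val by (rule frob_inj)
  then have "(x ^ q + x) + (y ^ q + y) = 0" by (simp add: two add_eq_0)
  then have "(x + y) ^ q + (x + y) = 0" unfolding frobs by (simp only: ac_simps)
  then have wq: "w ^ q = w" unfolding w_def add_eq_0 .
  define W X s t where "W = w ^ Q" and "X = x ^ Q" and "s = X ^ q + X" and "t = x ^ q + x"
  have Wq: "W ^ q = W" unfolding W_def swap[symmetric] wq ..
  have eq1: "X ^ q * X = x * (X ^ q + X + 1)"
    using critical_equation[OF char2 d' x] by (simp add: X_def q_def Q_def)
  have eq2: "(X ^ q + W) * (X + W) = (x + w) * (X ^ q + X + 1)"
  proof -
    have "y ^ Q = X + W" by (simp add: y_eq frobs X_def W_def)
    then have "(X + W) ^ q * (X + W) = y * ((X + W) ^ q + (X + W) + 1)"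
      using critical_equation[OF char2 d' y] by (simp add: q_def Q_def)
    moreover have "X ^ q + W + (X + W) + 1 = X ^ q + X + 1 + (W + W)" by (simp only: ac_simps)
    ultimately show ?thesis unfolding y_eq frobs Wq two by simp
  qed
  \<comment> \<open>Adding \<open>eq1\<close> to \<open>eq2\<close> removes the terms free of
    \<open>w\<close> and \<open>W\<close>. What remains is linear in \<open>s\<close> with
    coefficients fixed by the \<open>q\<close>-th power, so \<open>s\<close> will be fixed too
    unless \<open>W = w\<close>.\<close>
  have lin: "(W + w) * s = w + W * W"
  proof -
    have "X ^ q * X + (W * s + W * W) = x * (X ^ q + X + 1) + (w * s + w)"
      using eq2 unfolding s_def by (simp add: algebra_simps)
    then have "W * s + W * W = w * s + w" unfolding eq1 by simp
    then have "(W * s + W * W) + (w * s + w) = 0" unfolding add_eq_0 .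
    then have "(W + w) * s + (w + W * W) = 0" by (simp add: algebra_simps)
    then show ?thesis unfolding add_eq_0 .
  qed
  show ?thesis
  proof (cases "W = w")
    case True
    then have "w * (w + 1) = 0" using lin two[of w] by (simp add: algebra_simps)
    then have "w = 0 \<or> w = 1"
      using add_eq_0 by auto
    then show ?thesis using y_eq by auto
  next
    case False
    then have nz: "W + w \<noteq> 0" by (simp add: add_eq_0)
    have "(W + w) * s ^ q = w + W * W"
      using arg_cong[OF lin, of "\<lambda>z. z ^ q"] by (simp add: power_mult_distrib frobs Wq wq)
    then have sq: "s ^ q = s" using lin nz by (metis mult_left_cancel)
    have tQ: "t ^ Q = s" by (simp add: t_def s_def frobs swap X_def)
    have Xq: "X ^ q = X + s" unfolding s_def using two[of X] by (simp add: add.left_commute)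
    have xq: "x ^ q = x + t" unfolding t_def using two[of x] by (simp add: add.left_commute)
    have eq3: "X * (X + s) = x * (s + 1)"
      using eq1 unfolding s_def[symmetric] unfolding Xq by (simp only: mult.commute)
    \<comment> \<open>The \<open>q\<close>-th power of \<open>eq3\<close>: its left side only swaps
      the factors \<open>X\<close> and \<open>X + s\<close>, while on the right \<open>x\<close>
      becomes \<open>x + t\<close>. Comparison yields \<open>t * (s + 1) = 0\<close>.\<close>
    have "(X + s) * (X + (s + s)) = (x + t) * (s + 1)"
      using arg_cong[OF eq3, of "\<lambda>z. z ^ q"] by (simp add: power_mult_distrib frobs Xq xq sq add.assoc)
    then have "(x + t) * (s + 1) = x * (s + 1)"
      using eq3 by (simp only: two add_0_right mult.commute[of X])
    then have "t * (s + 1) = 0" by (simp only: distrib_right[of x t] add_cancel_left_right)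
    moreover have "s \<noteq> 1"
    proof
      assume "s = 1"
      then have "X * (X + 1) = 0" using eq3 two[of 1] by simp
      then have "X = 0 \<or> X = 1" using add_eq_0 by auto
      then have "x = 0 \<or> x = 1"
        using frob_inj[of x k 1] by (auto simp: X_def Q_def)
      then show False using neq[OF x] by auto
    qed
    ultimately have "t = 0" using add_eq_0 by auto
    then have s0: "s = 0" using tQ by (auto simp: Q_def power_0_left)
    \<comment> \<open>Since \<open>2 * Q = 2 ^ r\<close>, the two premises say that \<open>z\<close>
      is fixed by the \<open>l\<close>-th and \<open>r\<close>-th powers of Frobenius, hence by the
      power \<open>gcd r l\<close>. This is where the condition on the gcd enters.\<close>
    have fix4: "z ^ 4 = z" if "z ^ q = z" "z ^ Q * z ^ Q = z" for z :: 'a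
    proof -
      have "z ^ 2 ^ r = z" using that(2) by (simp add: k Q_def mult_2 power_add)
      then have "z ^ 2 ^ gcd r l = z"
        using that(1) unfolding q_def by (intro frobenius_fixed_gcd)
      with g have "z ^ 2 ^ 1 = z \<or> z ^ 2 ^ 2 = z" by auto
      then show ?thesis by (auto simp: power2_eq_square power4_eq_xxxx)
    qed
    have "x ^ 4 = x"
      using eq3 s0 xq \<open>t = 0\<close> by (intro fix4) (auto simp: X_def)
    moreover have "w ^ 4 = w"
      using lin s0 wq char_2_add_eq_0_iff[OF char2, of w "W * W"] by (intro fix4) (auto simp: W_def)
    ultimately have "y ^ 4 = y"
      using frob[of x w 2] by (simp add: y_eq)
    have quad: "z * z + z + 1 = 0" if "z ^ 4 = z" "z ^ d = (z + 1) ^ d" for z :: 'a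
    proof -
      have "z * (z + 1) * (z * z + z + 1) = 0"
      proof -
        have "z * (z + 1) * (z * z + z + 1) = (z ^ 4 + z) + (z ^ 3 + z ^ 3) + (z ^ 2 + z ^ 2)"
          by (simp add: algebra_simps power2_eq_square power3_eq_cube power4_eq_xxxx)
        then show ?thesis by (simp only: that(1) two add_0_right)
      qed
      then show ?thesis
        using neq[OF that(2)] add_eq_0[of z 1] by (metis mult_eq_0_iff)
    qed
    have "(x + y) * (x + y + 1) + (1 + 1) = (x * x + x + 1) + (y * y + y + 1) + (x * y + x * y)"
      by (simp add: algebra_simps)
    then have "(x + y) * (x + y + 1) = 0"
      by (simp only: quad[OF \<open>x ^ 4 = x\<close> x] quad[OF \<open>y ^ 4 = y\<close> y] two add_0_right)
    then have "x + y = 0 \<or> (x + 1) + y = 0" by (simp add: ac_simps)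
    then show ?thesis using add_eq_0 by auto
  qed
qed

section \<open>Symmetric powers of \<open>x\<close> and \<open>x + 1\<close>\<close>

text \<open>In characteristic two these are the power sums of the roots \<open>x\<close> and
  \<open>x + 1\<close> of \<open>T^2 + T + z\<close>, written in \<open>z = x * (x + 1)\<close>; the
  initial value 0 is \<open>1 + 1\<close>.\<close>

fun shift_poly :: "nat \<Rightarrow> 'a::comm_ring_1 poly" where
  "shift_poly 0 = 0"
| "shift_poly (Suc 0) = 1"
| "shift_poly (Suc (Suc j)) = shift_poly (Suc j) + [:0, 1:] * shift_poly j"

lemma coeff_shift_poly_eq_0: "j < 2 * k + 1 \<Longrightarrow> coeff (shift_poly j) k = 0"
  by (induction j arbitrary: k rule: shift_poly.induct)
     (auto simp: coeff_pCons split: nat.splits)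

lemma coeff_shift_poly_odd: "coeff (shift_poly (2 * k + 1)) k = 1"
  by (induction k) (auto simp: coeff_shift_poly_eq_0)

lemma pcompose_shift_poly:
  assumes "CHAR('a::field) = 2"
  shows "pcompose (shift_poly j) [:0, 1, 1:] = [:0, 1:] ^ j + ([:1, 1:] ^ j :: 'a poly)"
proof -
  have two: "1 + 1 = (0 :: 'a poly)"
    using assms by (intro char_2_add_self) simp
  show ?thesis
  proof (induction j rule: shift_poly.induct)
    case 1
    then show ?case using two by simp
  next
    case 2
    then show ?case using char_2_add_self[OF assms, of 1] by (simp add: pcompose_1 one_pCons)
  next
    case (3 j)
    define X where "X = [:0, 1 :: 'a:]"
    have eqs: "pcompose [:0, 1:] [:0, 1, 1 :: 'a:] = X * (X + 1)" "[:0, 1:] = X" "[:1, 1:] = X + 1"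
      by (simp_all add: X_def pcompose_pCons one_pCons)
    define Y Z where "Y = X ^ j" and "Z = (X + 1) ^ j"
    have "X * Y + (X + 1) * Z + X * (X + 1) * (Y + Z) =
        X * (X * Y) + (X + 1) * ((X + 1) * Z) + (1 + 1) * (X * Y)"
      by (simp add: algebra_simps)
    then show ?case
      unfolding shift_poly.simps pcompose_add pcompose_mult 3 eqs(1)
      unfolding eqs(2,3) power_Suc Y_def[symmetric] Z_def[symmetric] two by simp
  qed
qed

lemma poly_shift_poly:
  assumes "CHAR('a::field) = 2"
  shows "poly (shift_poly j) (x * (x + 1)) = x ^ j + ((x + 1) ^ j :: 'a)"
  using arg_cong[OF pcompose_shift_poly[OF assms, of j], of "\<lambda>p. poly p x"]
  by (simp add: poly_pcompose algebra_simps)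

lemma pcompose_inj:
  fixes p p' q :: "'a::idom poly"
  assumes "pcompose p q = pcompose p' q" "degree q > 0"
  shows "p = p'"
  using pcompose_eq_0[of "p - p'" q] assms by (simp add: pcompose_diff)

text \<open>Squaring is additive in characteristic two; the identity is checked after the injective
  substitution \<open>z = x + x^2\<close>.\<close>

lemma shift_poly_double:
  assumes "CHAR('a::field) = 2"
  shows "shift_poly (2 * j) = (shift_poly j ^ 2 :: 'a poly)"
proof (rule pcompose_inj[where q = "[:0, 1, 1:]"])
  have "CHAR('a poly) = 2" using assms by simp
  then show "pcompose (shift_poly (2 * j)) [:0, 1, 1:] = pcompose (shift_poly j ^ 2 :: 'a poly) [:0, 1, 1:]"
    using freshmans_dream'[where 'a = "'a poly", of "2 ^ 1" 1 "[:0, 1:] ^ j" "[:1, 1:] ^ j"]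
    by (simp add: pcompose_shift_poly[OF assms] power2_eq_square pcompose_mult power_add mult_2)
qed simp

text \<open>The inner polynomial \<open>x + x^2\<close> has derivative 1, so differentiation
  commutes with this substitution and can be carried out on
  \<open>x ^ j + (x + 1) ^ j\<close>.\<close>

lemma pderiv_shift_poly:
  assumes "CHAR('a::field) = 2"
  shows "pderiv (shift_poly j) = Polynomial.smult (of_nat j) (shift_poly (j - 1) :: 'a poly)"
proof (rule pcompose_inj[where q = "[:0, 1, 1:]"])
  have "pderiv [:0, 1, 1 :: 'a:] = 1"
    using char_2_add_self[OF assms, of 1] by (simp add: pderiv_pCons one_pCons)
  then have "pcompose (pderiv (shift_poly j)) [:0, 1, 1:] = pderiv (pcompose (shift_poly j) [:0, 1, 1 :: 'a:])"
    by (simp add: pderiv_pcompose)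
  also have "\<dots> = Polynomial.smult (of_nat j) ([:0, 1:] ^ (j - 1) + [:1, 1:] ^ (j - 1))"
    by (simp add: pcompose_shift_poly[OF assms] pderiv_add pderiv_power smult_add_right pderiv_pCons)
  finally show "pcompose (pderiv (shift_poly j)) [:0, 1, 1:] =
      pcompose (Polynomial.smult (of_nat j) (shift_poly (j - 1) :: 'a poly)) [:0, 1, 1:]"
    by (simp add: pcompose_smult pcompose_shift_poly[OF assms])
qed simp

section \<open>Critical points in characteristic two\<close>

lemma char_2_minus:
  assumes "CHAR('a::comm_ring_1) = 2"
  shows "- x = (x :: 'a)"
  using char_2_add_self[OF assms, of x] by (simp add: eq_neg_iff_add_eq_0 flip: neg_eq_iff_add_eq_0)

lemma char_2_of_nat:
  assumes "CHAR('a::comm_ring_1) = 2"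
  shows "of_nat n = (if even n then 0 else 1 :: 'a)"
  using char_2_add_self[OF assms, of 1] by (induction n) auto

lemma char_2_square_add:
  assumes "CHAR('a::field) = 2"
  shows "(x + y :: 'a)\<^sup>2 = x\<^sup>2 + y\<^sup>2"
  using frobenius_add[OF assms, of x y 1] by simp

lemma char_2_square_sum:
  assumes "CHAR('a::field) = 2"
  shows "(\<Sum>i\<in>I. f i :: 'a)\<^sup>2 = (\<Sum>i\<in>I. (f i)\<^sup>2)"
  by (induction I rule: infinite_finite_induct) (simp_all add: char_2_square_add[OF assms])

lemma char_2_square_inj:
  assumes "CHAR('a::field) = 2" "(x :: 'a)\<^sup>2 = y\<^sup>2"
  shows "x = y"
  using frobenius_inj[OF assms(1), of x 1 y] assms(2) by simp

definition alg_closed_char_2 :: "'a::field itself \<Rightarrow> bool" where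
  "alg_closed_char_2 _ \<longleftrightarrow> CHAR('a) = 2 \<and> (\<forall>p :: 'a poly. degree p > 0 \<longrightarrow> (\<exists>x. poly p x = 0))"

lemma linear_factors_exist:
  fixes p :: "'a::field poly"
  assumes K: "alg_closed_char_2 TYPE('a)"
  shows "\<exists>ts. length ts = degree p \<and> p = Polynomial.smult (lead_coeff p) (\<Prod>t\<leftarrow>ts. [:t, 1:])"
proof (induction "degree p" arbitrary: p)
  case 0
  then show ?case by (auto elim!: degree_eq_zeroE)
next
  case (Suc n)
  then have "degree p > 0" by simp
  then obtain x where "poly p x = 0" using K unfolding alg_closed_char_2_def by blast
  then have "[:x, 1:] dvd p"
    using K by (simp add: poly_eq_0_iff_dvd alg_closed_char_2_def char_2_minus)
  then obtain q where q: "p = [:x, 1:] * q" by blast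
  with Suc(2) have "q \<noteq> 0" by auto
  then have deg: "degree p = Suc (degree q)" unfolding q by (subst degree_mult_eq) auto
  obtain ts where "length ts = degree q" "q = Polynomial.smult (lead_coeff q) (\<Prod>t\<leftarrow>ts. [:t, 1:])"
    using Suc(1)[of q] Suc(2) deg by auto
  moreover have "lead_coeff p = lead_coeff q" unfolding q lead_coeff_mult by simp
  ultimately show ?case
    using q deg by (intro exI[of _ "x # ts"]) (simp add: mult_smult_right[symmetric] del: mult_pCons_left mult_smult_right)
qed

lemma square_factor_of_prod_list:
  fixes xs :: "'a::comm_monoid_mult list"
  assumes "i < length xs" "j < length xs" "i \<noteq> j"
  shows "\<exists>q. prod_list xs = xs ! i * xs ! j * q"
proof -
  have "prod_list xs = (\<Prod>k<length xs. xs ! k)"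
    by (simp add: prod.list_conv_set_nth atLeast0LessThan)
  also have "\<dots> = xs ! i * (xs ! j * (\<Prod>k\<in>{..<length xs} - {i} - {j}. xs ! k))"
    using assms by (simp add: prod.remove[of _ i] prod.remove[of _ j])
  finally show ?thesis by (auto simp: mult.assoc)
qed

text \<open>The map \<open>\<phi>\<close> serves as the identity and as squaring; the latter passes
  from critical points to their squares in the variable \<open>w\<close>.\<close>

lemma prod_list_root:
  fixes ts :: "'b list" and \<phi> :: "'b \<Rightarrow> 'a::field"
  assumes "CHAR('a) = 2" "i < length ts"
  shows "poly (\<Prod>t\<leftarrow>ts. [:\<phi> t, 1:]) (\<phi> (ts ! i)) = 0"
proof -
  have "poly (\<Prod>t\<leftarrow>ts. [:\<phi> t, 1:]) x = (\<Prod>t\<leftarrow>ts. \<phi> t + x)" for x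
    by (induction ts) (auto simp: algebra_simps)
  then show ?thesis
    using char_2_add_self[OF assms(1)] nth_mem[OF assms(2)]
    by (force simp: prod_list_zero_iff)
qed

lemma prod_list_double_root:
  fixes ts :: "'b list" and \<phi> :: "'b \<Rightarrow> 'a::field"
  assumes "CHAR('a) = 2" "i < length ts" "j < length ts" "i \<noteq> j" "\<phi> (ts ! i) = \<phi> (ts ! j)"
  shows "poly (pderiv (\<Prod>t\<leftarrow>ts. [:\<phi> t, 1:])) (\<phi> (ts ! i)) = 0"
proof -
  obtain q where "(\<Prod>t\<leftarrow>ts. [:\<phi> t, 1:]) = [:\<phi> (ts ! i), 1:] * [:\<phi> (ts ! i), 1:] * q"
    using square_factor_of_prod_list[of i "map (\<lambda>t. [:\<phi> t, 1:]) ts" j] assms by auto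
  then show ?thesis
    by (simp add: pderiv_mult char_2_add_self[OF assms(1)] del: mult_pCons_left mult_pCons_right)
qed

text \<open>A repeated entry in a list of linear factors would be a common root of \<open>p\<close>
  and its derivative.\<close>

lemma card_roots_separable:
  fixes p :: "'a::field poly"
  assumes K: "alg_closed_char_2 TYPE('a)" and "p \<noteq> 0"
    and sep: "\<And>x. poly p x = 0 \<Longrightarrow> poly (pderiv p) x \<noteq> 0"
  shows "card {x. poly p x = 0} = degree p"
proof -
  have char2: "CHAR('a) = 2" using K by (simp add: alg_closed_char_2_def)
  obtain ts where ts: "length ts = degree p" "p = Polynomial.smult (lead_coeff p) (\<Prod>t\<leftarrow>ts. [:t, 1:])"
    using linear_factors_exist[OF K] by blast
  have root: "poly p (ts ! i) = 0" if "i < length ts" for i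
    using prod_list_root[OF char2 that, of "\<lambda>x. x"] by (subst ts) simp
  have "distinct ts"
  proof (rule ccontr)
    assume "\<not> distinct ts"
    then obtain i j where ij: "i < length ts" "j < length ts" "i \<noteq> j" "ts ! i = ts ! j"
      by (auto simp: distinct_conv_nth)
    have "poly (pderiv p) (ts ! i) = 0"
      using prod_list_double_root[OF char2 ij(1-3), of "\<lambda>x. x"] ij(4) by (subst ts) (simp add: pderiv_smult)
    then show False using sep root ij(1) by blast
  qed
  then have "degree p = card (set ts)" using ts by (simp add: distinct_card)
  also have "\<dots> \<le> card {x. poly p x = 0}"
    using root \<open>p \<noteq> 0\<close> by (intro card_mono poly_roots_finite) (auto simp: in_set_conv_nth)
  finally show ?thesis using card_poly_roots_bound[OF \<open>p \<noteq> 0\<close>] by simp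
qed

text \<open>In characteristic two only the odd-index coefficients of \<open>p\<close> survive
  differentiation, so the derivative is a polynomial in \<open>x^2\<close>; this is that
  polynomial.\<close>

definition odd_part :: "'a::comm_ring_1 poly \<Rightarrow> 'a poly" where
  "odd_part p = (\<Sum>i\<le>degree p. monom (coeff p (2 * i + 1)) i)"

lemma coeff_odd_part [simp]: "coeff (odd_part p) i = coeff p (2 * i + 1)"
  by (auto simp: odd_part_def coeff_sum coeff_eq_0 if_distrib cong: if_cong)

lemma coeff_pcompose_square:
  fixes p :: "'a::comm_ring_1 poly"
  shows
  "coeff (pcompose p [:0, 0, 1:]) n = (if even n then coeff p (n div 2) else 0)"
proof (induction p arbitrary: n)
  case (pCons a p)
  consider "n = 0" | "n = 1" | k where "n = Suc (Suc k)" by (metis One_nat_def not0_implies_Suc)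
  then show ?case
    by cases (simp_all add: pcompose_pCons coeff_pCons pCons.IH)
qed simp

lemma pderiv_eq_odd_part_square:
  fixes p :: "'a::field poly"
  assumes "CHAR('a) = 2"
  shows "pderiv p = pcompose (odd_part p) [:0, 0, 1:]"
  by (rule poly_eqI)
     (auto simp: coeff_pderiv coeff_pcompose_square char_2_of_nat[OF assms] simp del: of_nat_Suc)

lemma poly_odd_part_square:
  fixes p :: "'a::field poly"
  assumes "CHAR('a) = 2"
  shows "poly (odd_part p) (x\<^sup>2) = poly (pderiv p) x"
  by (simp add: pderiv_eq_odd_part_square[OF assms] poly_pcompose power2_eq_square)

lemma pcompose_prod_square:
  fixes ts :: "'a::field list"
  assumes "CHAR('a) = 2"
  shows "pcompose (\<Prod>t\<leftarrow>ts. [:t\<^sup>2, 1:]) [:0, 0, 1:] = (\<Prod>t\<leftarrow>ts. [:t, 1:] ^ 2)"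
proof (induction ts)
  case (Cons t ts)
  have "pcompose [:t\<^sup>2, 1:] [:0, 0, 1:] = [:t, 1:] ^ 2"
    using char_2_add_self[OF assms, of t] by (simp add: pcompose_pCons power2_eq_square)
  then show ?case by (simp only: list.map prod_list.Cons pcompose_mult Cons)
qed (simp add: pcompose_1)

text \<open>Substituting \<open>x^2\<close> is injective and turns \<open>x + t^2\<close> into
  \<open>(x + t)^2\<close>.\<close>

lemma odd_part_factorization:
  fixes g :: "'a::field poly"
  assumes "CHAR('a) = 2"
  shows "pderiv g = Polynomial.smult c (\<Prod>t\<leftarrow>ts. [:t, 1:] ^ 2) \<longleftrightarrow>
         odd_part g = Polynomial.smult c (\<Prod>t\<leftarrow>ts. [:t\<^sup>2, 1:])"
  using pcompose_inj[of "odd_part g" "[:0, 0, 1:]" "Polynomial.smult c (\<Prod>t\<leftarrow>ts. [:t\<^sup>2, 1:])"]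
  by (auto simp: pderiv_eq_odd_part_square[OF assms] pcompose_smult pcompose_prod_square[OF assms])

text \<open>The odd part has degree \<open>N\<close> and splits into linear factors; square roots of
  its roots give the list.\<close>

lemma critical_points_exist:
  fixes g :: "'a::field poly"
  assumes K: "alg_closed_char_2 TYPE('a)"
    and g: "degree g \<le> 2 * N + 1" "coeff g (2 * N + 1) \<noteq> 0"
  shows "\<exists>ts. length ts = N \<and> pderiv g = Polynomial.smult (coeff g (2 * N + 1)) (\<Prod>t\<leftarrow>ts. [:t, 1:] ^ 2)"
proof -
  have char2: "CHAR('a) = 2" using K by (simp add: alg_closed_char_2_def)
  have "degree (odd_part g) = N"
    using g by (intro antisym degree_le le_degree) (auto simp: coeff_eq_0)
  then obtain ws where ws: "length ws = N"
    "odd_part g = Polynomial.smult (coeff g (2 * N + 1)) (\<Prod>w\<leftarrow>ws. [:w, 1:])"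
    using linear_factors_exist[OF K, of "odd_part g"] by auto
  have "\<exists>t. t\<^sup>2 = w" for w :: 'a
  proof -
    have "degree [:w, 0, 1:] > 0" by simp
    then obtain t where "poly [:w, 0, 1:] t = 0" using K unfolding alg_closed_char_2_def by blast
    then show ?thesis using char_2_add_eq_0_iff[OF char2, of w "t\<^sup>2"] by (auto simp: power2_eq_square)
  qed
  then obtain \<sigma> where \<sigma>: "\<And>w :: 'a. (\<sigma> w)\<^sup>2 = w" by metis
  show ?thesis
    using ws unfolding odd_part_factorization[OF char2]
    by (intro exI[of _ "map \<sigma> ws"]) (simp add: \<sigma> comp_def)
qed

lemma smult_left_cancel:
  fixes p q :: "'a::field poly"
  assumes "c \<noteq> 0" "Polynomial.smult c p = Polynomial.smult c q"
  shows "p = q"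
  using arg_cong[OF assms(2), of "Polynomial.smult (inverse c)"] assms(1) by simp

text \<open>The scalars balance: \<open>c ^ (2 * N + 1)\<close> from the coefficient is the chain
  rule factor \<open>c\<close> times \<open>c ^ (2 * N)\<close> from the \<open>N\<close> squared
  factors.\<close>

lemma critical_points_scale:
  fixes G :: "'a::field poly"
  assumes c: "c \<noteq> 0" and "length ts = N"
    and ts: "pderiv (pcompose G [:0, c:]) =
      Polynomial.smult (coeff (pcompose G [:0, c:]) (2 * N + 1)) (\<Prod>t\<leftarrow>ts. [:t, 1:] ^ 2)"
  shows "pderiv G = Polynomial.smult (coeff G (2 * N + 1)) (\<Prod>t\<leftarrow>map ((*) c) ts. [:t, 1:] ^ 2)"
proof (rule pcompose_inj[where q = "[:0, c:]"])
  have "pcompose (\<Prod>t\<leftarrow>map ((*) c) ts. [:t, 1:] ^ 2) [:0, c:] =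
      Polynomial.smult (c ^ (2 * length ts)) (\<Prod>t\<leftarrow>ts. [:t, 1:] ^ 2)"
  proof (induction ts)
    case (Cons t ts)
    have "pcompose ([:c * t, 1:] ^ 2) [:0, c:] = Polynomial.smult (c ^ 2) ([:t, 1:] ^ 2)"
      by (simp add: power2_eq_square pcompose_mult pcompose_pCons algebra_simps)
    then show ?case
      by (simp only: list.map prod_list.Cons pcompose_mult Cons length_Cons mult_smult_left
          mult_smult_right smult_smult power_add mult_Suc_right mult.commute[of "c ^ 2" "c ^ (2 * length ts)"])
  qed (simp add: pcompose_1)
  then have "Polynomial.smult c (pcompose (Polynomial.smult (coeff G (2 * N + 1)) (\<Prod>t\<leftarrow>map ((*) c) ts. [:t, 1:] ^ 2)) [:0, c:])
      = pderiv (pcompose G [:0, c:])"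
    unfolding ts using \<open>length ts = N\<close> by (simp add: pcompose_smult mult_ac coeff_pcompose_linear)
  also have "\<dots> = Polynomial.smult c (pcompose (pderiv G) [:0, c:])"
    by (simp add: pderiv_pcompose pderiv_pCons)
  finally show "pcompose (pderiv G) [:0, c:] =
      pcompose (Polynomial.smult (coeff G (2 * N + 1)) (\<Prod>t\<leftarrow>map ((*) c) ts. [:t, 1:] ^ 2)) [:0, c:]"
    using smult_left_cancel[OF c] by metis
qed (use c in simp)

text \<open>Existence of a factorization makes the \<open>SOME\<close> in \<open>Pi_d\<close> an
  actual list of critical points. A vanishing product has a vanishing factor, and diagonal factors
  are 1.\<close>

lemma Pi_d_eq_0_imp:
  fixes g :: "'a::field poly"
  assumes K: "alg_closed_char_2 TYPE('a)" and d: "d = 2 * N + 1"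
    and g: "degree g \<le> d" "coeff g d \<noteq> 0" "Pi_d d g = 0"
  obtains ts i j where "length ts = N" "pderiv g = Polynomial.smult (coeff g d) (\<Prod>t\<leftarrow>ts. [:t, 1:] ^ 2)"
    "i < N" "j < N" "i \<noteq> j" "poly g (ts ! i) = poly g (ts ! j)"
proof -
  define ts where "ts = (SOME ts :: 'a list. length ts = (d - 1) div 2 \<and>
        pderiv g = Polynomial.smult (coeff g d) (\<Prod>t\<leftarrow>ts. [:t, 1:] ^ 2))"
  have "\<exists>ts :: 'a list. length ts = (d - 1) div 2 \<and>
        pderiv g = Polynomial.smult (coeff g d) (\<Prod>t\<leftarrow>ts. [:t, 1:] ^ 2)"
    using critical_points_exist[OF K, of g N] g d by simp
  from someI_ex[OF this] have ts: "length ts = N"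
    "pderiv g = Polynomial.smult (coeff g d) (\<Prod>t\<leftarrow>ts. [:t, 1:] ^ 2)"
    unfolding ts_def[symmetric] using d by auto
  have "(\<Prod>i<length ts. \<Prod>j<length ts. if i \<noteq> j then poly g (ts ! i) - poly g (ts ! j) else 1) = 0"
    using g(3) unfolding Pi_d_def ts_def[symmetric] Let_def .
  then obtain i j where "i < N" "j < N" "(if i \<noteq> j then poly g (ts ! i) - poly g (ts ! j) else 1) = 0"
    using ts(1) by (auto simp only: prod_zero_iff finite_lessThan lessThan_iff)
  then show thesis using that[OF ts] by (auto split: if_splits)
qed

section \<open>The rescaled family\<close>

lemma eval2_specialize:
  fixes p :: "'a::idom poly poly"
  assumes "\<And>i. poly (coeff p i) b = coeff q i"
  shows "eval2 p w b = poly q w" "eval2 (pderiv p) w b = poly (pderiv q) w"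
proof -
  have *: "eval2 p w b = poly q w" if "\<And>i. poly (coeff p i) b = coeff q i" for p q
  proof -
    define M where "M = Suc (max (degree p) (degree q))"
    have p: "\<forall>i\<ge>M. coeff p i = 0" and q: "\<forall>i\<ge>M. coeff q i = 0"
      by (auto simp: M_def coeff_eq_0)
    have "eval2 p w b = (\<Sum>i<M. coeff q i * w ^ i)"
      by (simp add: eval2_conv_sum[OF p] that)
    also have "\<dots> = poly q w"
      by (subst (2) poly_as_sum_of_monoms_less[OF q]) (simp add: poly_sum poly_monom)
    finally show ?thesis .
  qed
  show "eval2 p w b = poly q w" "eval2 (pderiv p) w b = poly (pderiv q) w"
    by (rule *; simp add: coeff_pderiv assms flip: of_nat_Suc of_nat_poly)+
qed

text \<open>With \<open>b = 1 / \<alpha>\<close> this is \<open>b ^ m\<close> times \<open>L\<^sub>\<alpha> f\<close> at \<open>\<alpha>\<^sup>2 z\<close>.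
  It extends to \<open>b = 0\<close>, that is \<open>\<alpha> = \<infinity>\<close>, where the statement can be decided by hand.\<close>
definition rescaled_L :: "nat \<Rightarrow> 'a::field poly \<Rightarrow> 'a \<Rightarrow> 'a poly" where
  "rescaled_L m f b = (\<Sum>j\<le>m. Polynomial.smult (coeff f j * b ^ (m - j)) (shift_poly j))"

definition rescaled_coeff :: "nat \<Rightarrow> 'a::field poly \<Rightarrow> nat \<Rightarrow> 'a poly" where
  "rescaled_coeff m f k = (\<Sum>j\<le>m. monom (coeff f j * coeff (shift_poly j) k) (m - j))"

lemma coeff_rescaled_L: "coeff (rescaled_L m f b) k = poly (rescaled_coeff m f k) b"
  by (simp add: rescaled_L_def rescaled_coeff_def coeff_sum poly_sum poly_monom mult_ac)

lemma smult_sum_right: "Polynomial.smult c (\<Sum>i\<in>I. p i) = (\<Sum>i\<in>I. Polynomial.smult c (p i))"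
  by (induction I rule: infinite_finite_induct) (auto simp: smult_add_right)

lemma degree_sum_monom_le:
  assumes "\<And>j. j \<in> J \<Longrightarrow> a j \<noteq> 0 \<Longrightarrow> e j \<le> n"
  shows "degree (\<Sum>j\<in>J. monom (a j) (e j)) \<le> n"
proof (cases "finite J")
  case True
  have "degree (monom (a j) (e j)) \<le> n" if "j \<in> J" for j
    using assms[OF that] by (cases "a j = 0") (auto simp: degree_monom_eq)
  with True show ?thesis by (intro degree_sum_le)
qed simp

lemma degree_rescaled_coeff_le: "degree (rescaled_coeff m f k) \<le> m - (2 * k + 1)"
  unfolding rescaled_coeff_def
proof (rule degree_sum_monom_le)
  fix j assume "coeff f j * coeff (shift_poly j) k \<noteq> 0"
  then show "m - j \<le> m - (2 * k + 1)" using coeff_shift_poly_eq_0[of j k] by (cases "j < 2 * k + 1") auto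
qed

lemma degree_rescaled_L_le:
  assumes "m = 2 * d + 2"
  shows "degree (rescaled_L m f b) \<le> d"
proof (rule degree_le, intro allI impI)
  fix k assume "d < k"
  then have "coeff (shift_poly j) k = (0 :: 'a)" if "j \<le> m" for j
    using that assms by (intro coeff_shift_poly_eq_0) auto
  then show "coeff (rescaled_L m f b) k = 0" by (simp add: rescaled_L_def coeff_sum)
qed

lemma rescaled_L_0: "rescaled_L m f 0 = Polynomial.smult (coeff f m) (shift_poly m)"
proof -
  have "rescaled_L m f 0 = (\<Sum>j\<le>m. if j = m then Polynomial.smult (coeff f m) (shift_poly m) else 0)"
    unfolding rescaled_L_def by (intro sum.cong) (auto simp: power_0_left)
  then show ?thesis by simp
qed

text \<open>Scaling \<open>x\<close> by \<open>1 / \<alpha>\<close> turns the shift by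
  \<open>\<alpha>\<close> into a shift by 1 and \<open>x * (x + \<alpha>)\<close> into its multiple
  by \<open>(1 / \<alpha>)\<^sup>2\<close>. The powers of \<open>\<alpha>\<close> match because
  \<open>\<alpha> ^ m * (1 / \<alpha>) ^ (m - j) = \<alpha> ^ j\<close>.\<close>

lemma L_op_eq_rescaled_L:
  fixes f :: "'a::field poly"
  assumes char2: "CHAR('a) = 2" and m: "m = 2 * d + 2" and f: "degree f \<le> m" and \<alpha>: "\<alpha> \<noteq> 0"
  shows "L_op d \<alpha> f = pcompose (Polynomial.smult (\<alpha> ^ m) (rescaled_L m f (1 / \<alpha>))) [:0, (1 / \<alpha>)\<^sup>2:]"
    (is "_ = ?g")
  unfolding L_op_def
proof (rule the_equality)
  define b where "b = 1 / \<alpha>"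
  have "\<alpha> * b = 1" using \<alpha> by (simp add: b_def)
  have "pcompose ?g [:0, \<alpha>, 1:] =
      pcompose (pcompose (Polynomial.smult (\<alpha> ^ m) (rescaled_L m f b)) [:0, 1, 1:]) [:0, b:]"
    using \<alpha> by (simp add: b_def power2_eq_square pcompose_pCons flip: pcompose_assoc)
  also have "\<dots> = (\<Sum>j\<le>m. Polynomial.smult (\<alpha> ^ m * (coeff f j * b ^ (m - j))) ([:0, b:] ^ j + [:1, b:] ^ j))"
  proof -
    have pow: "pcompose (p ^ j) q = pcompose p q ^ j" for p q :: "'a poly" and j
      by (induction j) (simp_all add: pcompose_1 pcompose_mult)
    show ?thesis
      by (simp add: rescaled_L_def pcompose_smult pcompose_sum pcompose_shift_poly[OF char2] pcompose_add pow
          pcompose_pCons smult_sum_right)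
  qed
  also have "\<dots> = (\<Sum>j\<le>m. Polynomial.smult (coeff f j) ([:0, 1:] ^ j + [:\<alpha>, 1:] ^ j))"
  proof (rule sum.cong)
    fix j assume "j \<in> {..m}"
    then have c: "\<alpha> ^ m * (coeff f j * b ^ (m - j)) = coeff f j * \<alpha> ^ j"
      using \<alpha> by (simp add: b_def power_divide power_diff)
    have p: "Polynomial.smult (\<alpha> ^ j) ([:0, b:] ^ j) = [:0, 1:] ^ j" "Polynomial.smult (\<alpha> ^ j) ([:1, b:] ^ j) = [:\<alpha>, 1:] ^ j"
      using \<open>\<alpha> * b = 1\<close> by (simp_all flip: smult_power)
    show "Polynomial.smult (\<alpha> ^ m * (coeff f j * b ^ (m - j))) ([:0, b:] ^ j + [:1, b:] ^ j) =
        Polynomial.smult (coeff f j) ([:0, 1:] ^ j + [:\<alpha>, 1:] ^ j)"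
      unfolding c by (simp only: smult_add_right p flip: smult_smult)
  qed simp
  also have "\<dots> = pcompose f [:\<alpha>, 1:] + f"
  proof -
    have "f = (\<Sum>j\<le>m. Polynomial.smult (coeff f j) ([:0, 1:] ^ j))"
      using poly_as_sum_of_monoms'[OF f] by (simp add: monom_altdef)
    moreover from this have "pcompose f [:\<alpha>, 1:] = (\<Sum>j\<le>m. Polynomial.smult (coeff f j) ([:\<alpha>, 1:] ^ j))"
    proof -
      have "pcompose ([:0, 1:] ^ j) [:\<alpha>, 1:] = [:\<alpha>, 1:] ^ j" for j
        by (induction j) (simp_all add: pcompose_1 pcompose_mult pcompose_pCons del: mult_pCons_left mult_pCons_right)
      then show ?thesis
        using arg_cong[OF \<open>f = _\<close>, of "\<lambda>p. pcompose p [:\<alpha>, 1:]"] by (simp add: pcompose_sum pcompose_smult)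
    qed
    ultimately show ?thesis by (simp add: smult_add_right sum.distrib add.commute)
  qed
  finally have spec: "pcompose ?g [:0, \<alpha>, 1:] = pcompose f [:\<alpha>, 1:] + f" .
  have "degree ?g \<le> d"
    using degree_pcompose_le[of "Polynomial.smult (\<alpha> ^ m) (rescaled_L m f (1 / \<alpha>))" "[:0, (1 / \<alpha>)\<^sup>2:]"]
      degree_rescaled_L_le[OF m, of f "1 / \<alpha>"] \<alpha> by simp
  with spec show "degree ?g \<le> d \<and> pcompose ?g [:0, \<alpha>, 1:] = pcompose f [:\<alpha>, 1:] + f" by simp
  fix g assume "degree g \<le> d \<and> pcompose g [:0, \<alpha>, 1:] = pcompose f [:\<alpha>, 1:] + f"
  with spec show "g = ?g" by (intro pcompose_inj[of g "[:0, \<alpha>, 1:]"]) auto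
qed

text \<open>For even \<open>j\<close> the derivative of \<open>shift_poly j\<close> is zero, which
  leaves no odd powers.\<close>

lemma coeff_shift_poly_even_odd:
  assumes "CHAR('a::field) = 2" "even j" "odd k"
  shows "coeff (shift_poly j) k = (0 :: 'a)"
proof -
  have "coeff (pderiv (shift_poly j) :: 'a poly) (k - 1) = 0"
    using assms(2) by (simp add: pderiv_shift_poly[OF assms(1)] char_2_of_nat[OF assms(1)])
  then show ?thesis
    using assms(3) by (simp add: coeff_pderiv char_2_of_nat[OF assms(1)] del: of_nat_Suc)
qed

text \<open>Additivity of squaring makes \<open>(poly p t)\<^sup>2\<close> a polynomial in
  \<open>t\<^sup>2\<close> with squared coefficients; for the derivative, \<open>of_nat k\<close> is
  its own square.\<close>

lemma char_2_poly_via_square: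
  fixes p :: "'a::field poly"
  assumes char2: "CHAR('a) = 2" and p: "\<forall>i\<ge>n. coeff p i = 0"
  shows "(\<Sum>k<n. (coeff p k)\<^sup>2 * (t\<^sup>2) ^ k) = (poly p t)\<^sup>2"
    and "(\<Sum>k<n. (coeff p k)\<^sup>2 * (of_nat k * (t\<^sup>2) ^ (k - 1))) = (poly (pderiv p) t)\<^sup>2"
proof -
  have "poly p t = (\<Sum>k<n. coeff p k * t ^ k)"
    by (subst poly_as_sum_of_monoms_less[OF p]) (simp add: poly_sum poly_monom)
  then show "(\<Sum>k<n. (coeff p k)\<^sup>2 * (t\<^sup>2) ^ k) = (poly p t)\<^sup>2"
    by (simp add: char_2_square_sum[OF char2] power_mult_distrib mult.commute flip: power_mult)
  have "poly (pderiv p) t = (\<Sum>k<n. coeff p k * (of_nat k * t ^ (k - 1)))"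
    by (subst poly_as_sum_of_monoms_less[OF p])
       (simp add: pderiv_sum_poly pderiv_monom poly_sum poly_monom mult_ac)
  moreover have "(of_nat k)\<^sup>2 = (of_nat k :: 'a)" for k
    by (simp add: char_2_of_nat[OF char2])
  ultimately show "(\<Sum>k<n. (coeff p k)\<^sup>2 * (of_nat k * (t\<^sup>2) ^ (k - 1))) = (poly (pderiv p) t)\<^sup>2"
    by (simp add: char_2_square_sum[OF char2] power_mult_distrib mult.commute flip: power_mult)
qed

text \<open>A common zero of \<open>shift_poly d\<close> and its derivative would give
  \<open>x ^ d = (x + 1) ^ d\<close> and the same for \<open>d - 1\<close>, hence
  \<open>x = 0\<close> and \<open>0 = 1\<close>. So the roots are simple. Their values differ by
  \<open>critical_points_separated\<close>.\<close>

lemma shift_poly_values: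
  assumes K: "alg_closed_char_2 TYPE('a::field)" and r: "r \<ge> 2" and g: "gcd r l \<in> {1, 2}"
    and m: "m = 2 ^ r * (2 ^ l + 1)" and md: "m = 2 * d + 2" and dN: "d = 2 * N + 1"
  defines "Z \<equiv> {z :: 'a. poly (shift_poly d) z = 0}"
  shows "finite Z" "card Z = N" "inj_on (poly (shift_poly m)) Z"
proof -
  have char2: "CHAR('a) = 2" using K by (simp add: alg_closed_char_2_def)
  note add_eq_0 = char_2_add_eq_0_iff[OF char2]
  have pre: "\<exists>x. z = x * (x + 1)" for z :: 'a
  proof -
    have "degree [:z, 1, 1:] > 0" by simp
    then obtain x where "poly [:z, 1, 1:] x = 0" using K unfolding alg_closed_char_2_def by blast
    then have "z + x * (x + 1) = 0" by (simp add: algebra_simps)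
    then show ?thesis using add_eq_0 by blast
  qed
  have deg: "degree (shift_poly d :: 'a poly) = N"
    using coeff_shift_poly_odd[of N, where 'a = 'a] dN
    by (intro antisym degree_le le_degree) (auto intro: coeff_shift_poly_eq_0)
  have nz: "shift_poly d \<noteq> (0 :: 'a poly)"
    using coeff_shift_poly_odd[of N, where 'a = 'a] dN by auto
  show "finite Z" unfolding Z_def using nz by (rule poly_roots_finite)
  have "poly (pderiv (shift_poly d)) z \<noteq> 0" if z: "poly (shift_poly d) z = 0" for z :: 'a
  proof
    assume "poly (pderiv (shift_poly d)) z = 0"
    then have z': "poly (shift_poly (2 * N)) z = 0"
      using dN by (simp add: pderiv_shift_poly[OF char2] char_2_of_nat[OF char2])
    obtain x where x: "z = x * (x + 1)" using pre by blast
    have "x ^ d = (x + 1) ^ d" "x ^ (2 * N) = (x + 1) ^ (2 * N)"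
      using z z' unfolding x poly_shift_poly[OF char2] add_eq_0 by auto
    then have "x * x ^ (2 * N) = (x + 1) * x ^ (2 * N)" using dN by simp
    then have "x ^ (2 * N) = 0" by (simp only: distrib_right mult_1 add_cancel_right_right)
    moreover from this have "x = 0" by simp
    ultimately show False using \<open>x ^ (2 * N) = (x + 1) ^ (2 * N)\<close> by (simp add: power_0_left)
  qed
  then show "card Z = N" unfolding Z_def using card_roots_separable[OF K nz] deg by simp
  show "inj_on (poly (shift_poly m)) Z"
  proof (rule inj_onI)
    fix z z' assume z: "z \<in> Z" "z' \<in> Z" "poly (shift_poly m) z = poly (shift_poly m) z'"
    obtain x y where xy: "z = x * (x + 1)" "z' = y * (y + 1)" using pre by metis
    have "y = x \<or> y = x + 1"
    proof (rule critical_points_separated[OF char2 r g m])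
      show "d = (m - 2) div 2" using md by simp
      show "x ^ d = (x + 1) ^ d" "y ^ d = (y + 1) ^ d"
        using z(1,2) unfolding Z_def mem_Collect_eq xy poly_shift_poly[OF char2] add_eq_0 by auto
      show "x ^ m + (x + 1) ^ m = y ^ m + (y + 1) ^ m"
        using z(3) unfolding xy poly_shift_poly[OF char2] .
    qed
    moreover have "x + 1 + 1 = x" using char_2_add_self[OF char2, of 1] by (simp add: add.assoc)
    ultimately show "z = z'" unfolding xy by (auto simp: mult.commute)
  qed
qed

theorem theorem3p5:
  fixes r l n m d e :: nat and f :: "'a::field poly"
  assumes K: "is_alg_closure_F2 TYPE('a)"
    and r: "r \<ge> 2" and l: "l \<ge> 1" and g: "gcd r l \<in> {1, 2}"
    and m: "m = 2 ^ r * (2 ^ l + 1)"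
    and d: "d = (m - 2) div 2"
    and e: "e = ((d - 1) div 2) choose 2"
    and n: "n \<ge> 1"
    and fdeg: "degree f \<le> m"
    and fcoeffs: "\<forall>i. coeff f i \<in> subfield_F2n n"
    and a0: "coeff f m \<noteq> 0" and a1: "coeff f (m - 1) \<noteq> 0"
  shows "finite {\<alpha>::'a. \<alpha> \<noteq> 0 \<and> Pi_d d (L_op d \<alpha> f) = 0}
    \<and> card {\<alpha>::'a. \<alpha> \<noteq> 0 \<and> Pi_d d (L_op d \<alpha> f) = 0} \<le> (5 * d + 4) * e"
proof -
  have acf: "alg_closed_char_2 TYPE('a)" and char2: "CHAR('a) = 2"
    using K by (auto simp: is_alg_closure_F2_def alg_closed_char_2_def)
  \<comment> \<open>Writing \<open>m = 4 * M\<close> with \<open>M \<ge> 3\<close> gives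
    \<open>d = 2 * M - 1\<close> and \<open>N = M - 1\<close>.\<close>
  obtain N where dN: "d = 2 * N + 1" and md: "m = 2 * d + 2" and N: "N \<ge> 2"
  proof -
    obtain r' l' where rl: "r = r' + 2" "l = l' + 1"
      using r l by (metis add.commute le_Suc_ex)
    define M :: nat where "M = 2 ^ r' * (2 * 2 ^ l' + 1)"
    have "M \<ge> 1 * (2 * 1 + 1)" unfolding M_def by (intro mult_mono add_mono) auto
    moreover have "m = 4 * M" by (simp add: m rl M_def)
    ultimately show thesis using that[of "M - 1"] d by auto
  qed
  have eN: "e = N choose 2" using e dN by simp

  \<comment> \<open>The families \<open>H\<close> and \<open>u\<close> over the parameter
    \<open>b\<close>\<close>
  define G where "G = rescaled_L m f"
  have Gdeg: "\<forall>k\<ge>Suc d. coeff (G b) k = 0" for b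
    using degree_rescaled_L_le[OF md, of f b] by (auto simp: G_def coeff_eq_0)
  define a where "a = coeff f (m - 1)"
  \<comment> \<open>These are the coefficients of the odd part of \<open>G b\<close> divided by
    \<open>a * b\<close>. The term \<open>j = m\<close> is absent because
    \<open>shift_poly m\<close> has no odd powers; all others contain a factor \<open>b\<close>, so
    the quotient is polynomial in \<open>b\<close> and makes sense at \<open>b = 0\<close>.\<close>
  define h where "h i = (\<Sum>j<m. monom (inverse a * coeff f j * coeff (shift_poly j) (2 * i + 1)) (m - 1 - j))" for i
  define H where "H = (\<Sum>i\<le>N. monom (h i) i)"
  define u where "u = (\<Sum>k<Suc d. monom ((rescaled_coeff m f k)\<^sup>2) k)"
  have h_G: "poly (h i) b * (a * b) = coeff (G b) (2 * i + 1)" for i b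
  proof -
    have "poly (h i) b * (a * b) = (\<Sum>j<m. coeff f j * coeff (shift_poly j) (2 * i + 1) * b ^ (m - j))"
      unfolding h_def poly_sum poly_monom sum_distrib_right
    proof (rule sum.cong)
      fix j assume "j \<in> {..<m}"
      then have "b ^ (m - j) = b ^ (m - 1 - j) * b" by (simp flip: power_Suc2 add: Suc_diff_Suc)
      then show "inverse a * coeff f j * coeff (shift_poly j) (2 * i + 1) * b ^ (m - 1 - j) * (a * b) =
          coeff f j * coeff (shift_poly j) (2 * i + 1) * b ^ (m - j)"
        using a1 by (simp add: a_def)
    qed simp
    also have "\<dots> = coeff (G b) (2 * i + 1)"
      using coeff_shift_poly_even_odd[OF char2, of m "2 * i + 1"] md
      by (simp add: G_def coeff_rescaled_L rescaled_coeff_def poly_sum poly_monom flip: lessThan_Suc_atMost)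
    finally show ?thesis .
  qed
  have h_0: "poly (h i) 0 = coeff (shift_poly (m - 1)) (2 * i + 1)" for i
  proof -
    have "poly (h i) 0 = (\<Sum>j<m. if j = m - 1 then coeff (shift_poly (m - 1)) (2 * i + 1) else 0)"
      unfolding h_def poly_sum poly_monom
      using a1 by (intro sum.cong) (auto simp: power_0_left a_def)
    then show ?thesis using md by simp
  qed
  have h_beyond: "h i = 0" if "i > N" for i
    unfolding h_def using that dN md by (intro sum.neutral ballI) (simp add: coeff_shift_poly_eq_0)
  have h_N: "h N = 1"
  proof -
    have "h N = (\<Sum>j<m. if j = m - 1 then 1 else 0)"
      unfolding h_def
    proof (rule sum.cong)
      fix j assume "j \<in> {..<m}"
      then consider "j = m - 1" | "j < 2 * (2 * N + 1) + 1" "j \<noteq> m - 1" using dN md by force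
      then show "monom (inverse a * coeff f j * coeff (shift_poly j) (2 * N + 1)) (m - 1 - j)
          = (if j = m - 1 then 1 else 0)"
      proof cases
        case 1
        have "m - 1 = 2 * (2 * N + 1) + 1" using dN md by simp
        then have "coeff (shift_poly j) (2 * N + 1) = (1 :: 'a)"
          using coeff_shift_poly_odd[of "2 * N + 1", where 'a = 'a] 1 by simp
        then show ?thesis using 1 a1 by (simp add: a_def monom_0 one_pCons)
      qed (simp add: coeff_shift_poly_eq_0)
    qed simp
    then show ?thesis using md by simp
  qed
  have coeff_H: "coeff H i = h i" for i
    using h_beyond by (auto simp: H_def coeff_sum if_distrib cong: if_cong)
  have coeff_u: "coeff u k = (if k < Suc d then (rescaled_coeff m f k)\<^sup>2 else 0)" for k
    by (auto simp: u_def coeff_sum if_distrib simp del: sum.lessThan_Suc cong: if_cong)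
  have u_beyond: "\<forall>k\<ge>Suc d. coeff u k = 0" by (simp add: coeff_u)
  have eval_u: "eval2 u (t\<^sup>2) b = (poly (G b) t)\<^sup>2" "eval2 (pderiv u) (t\<^sup>2) b = (poly (pderiv (G b)) t)\<^sup>2" for t b
    unfolding eval2_conv_sum[OF u_beyond] eval2_pderiv_conv_sum[OF u_beyond] char_2_poly_via_square[OF char2 Gdeg, symmetric]
    by (auto simp: coeff_u G_def coeff_rescaled_L intro!: sum.cong simp del: sum.lessThan_Suc)
  have eval_H: "eval2 H w b = poly (odd_part (G b)) w / (a * b)"
    "eval2 (pderiv H) w b = poly (pderiv (odd_part (G b))) w / (a * b)" if "b \<noteq> 0" for w b
  proof -
    have "poly (coeff H i) b = coeff (Polynomial.smult (inverse (a * b)) (odd_part (G b))) i" for i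
      using that a1 h_G[of i b] by (simp add: coeff_H a_def field_simps)
    from eval2_specialize[OF this]
    show "eval2 H w b = poly (odd_part (G b)) w / (a * b)"
      "eval2 (pderiv H) w b = poly (pderiv (odd_part (G b))) w / (a * b)"
      by (simp_all add: pderiv_smult field_simps)
  qed
  \<comment> \<open>At \<open>b = 0\<close> only \<open>shift_poly (m - 1)\<close> remains; its
    derivative is \<open>shift_poly (2 * d)\<close>, a square.\<close>
  have eval_H_0: "eval2 H (z\<^sup>2) 0 = (poly (shift_poly d) z)\<^sup>2" for z
  proof -
    have "eval2 H (z\<^sup>2) 0 = poly (odd_part (shift_poly (m - 1))) (z\<^sup>2)"
      by (rule eval2_specialize) (simp add: coeff_H h_0)
    also have "\<dots> = poly (shift_poly (2 * d)) z"
      using md by (simp add: poly_odd_part_square[OF char2] pderiv_shift_poly[OF char2] char_2_of_nat[OF char2])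
    finally show ?thesis by (simp add: shift_poly_double[OF char2])
  qed

  \<comment> \<open>The polynomial \<open>P\<close> that detects coincidences\<close>
  define Z where "Z = {z :: 'a. poly (shift_poly d) z = 0}"
  note Z = shift_poly_values[OF acf r g m md dN, folded Z_def]
  obtain P where P: "P \<noteq> 0" "degree P \<le> (4 * d + 2) * (N choose 2)"
    and P1: "\<And>b w w'. eval2 H w b = 0 \<Longrightarrow> eval2 H w' b = 0 \<Longrightarrow> w \<noteq> w' \<Longrightarrow>
        eval2 u w b = eval2 u w' b \<Longrightarrow> poly P b = 0"
    and P2: "\<And>b w. eval2 H w b = 0 \<Longrightarrow> eval2 (pderiv H) w b = 0 \<Longrightarrow> eval2 (pderiv u) w b = 0 \<Longrightarrow>
        poly P b = 0"
  proof (rule coincidence_polynomial)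
    show "coeff H N = 1" by (simp add: coeff_H h_N)
    show "degree H \<le> N" using h_beyond by (intro degree_le) (simp add: coeff_H)
    show "N \<ge> 2" by (rule N)
    show "weight_le 4 (4 * N) H"
      unfolding H_def
    proof (intro weight_le_sum weight_le_monom)
      fix i assume "i \<in> {..N}"
      have "degree (h i) \<le> m - 1 - (2 * (2 * i + 1) + 1)"
        unfolding h_def
      proof (rule degree_sum_monom_le)
        fix j assume "inverse a * coeff f j * coeff (shift_poly j) (2 * i + 1) \<noteq> 0"
        then have "\<not> j < 2 * (2 * i + 1) + 1" using coeff_shift_poly_eq_0[of j "2 * i + 1"] by auto
        then show "m - 1 - j \<le> m - 1 - (2 * (2 * i + 1) + 1)" by simp
      qed
      \<comment> \<open>Here \<open>m - 1 = 4 * N + 3\<close>, so \<open>h i\<close> has degree at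
        most \<open>4 * (N - i)\<close>: the source of the weight 4.\<close>
      then show "degree (h i) + 4 * i \<le> 4 * N" using md dN \<open>i \<in> {..N}\<close> by auto
    qed
    show "weight_le 4 (4 * d + 2) u"
      unfolding u_def
    proof (intro weight_le_sum weight_le_monom)
      fix k assume "k \<in> {..<Suc d}"
      \<comment> \<open>Squaring doubles the degree bound \<open>m - (2 * k + 1)\<close>, which
        gives \<open>4 * d + 2 - 4 * k\<close>.\<close>
      then show "degree ((rescaled_coeff m f k)\<^sup>2) + 4 * k \<le> 4 * d + 2"
        using degree_power_le[of "rescaled_coeff m f k" 2] degree_rescaled_coeff_le[of m f k] md by auto
    qed
    show "finite ((\<lambda>z. z\<^sup>2) ` Z)" using Z(1) by simp
    show "eval2 H w 0 = 0" if "w \<in> (\<lambda>z. z\<^sup>2) ` Z" for w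
      using that by (auto simp: eval_H_0 Z_def)
    have "inj_on (\<lambda>z. eval2 u (z\<^sup>2) 0) Z"
    proof (rule inj_onI)
      fix z z' assume z: "z \<in> Z" "z' \<in> Z" and eq: "eval2 u (z\<^sup>2) 0 = eval2 u (z'\<^sup>2) 0"
      from eq have "poly (G 0) z = poly (G 0) z'"
        unfolding eval_u by (rule char_2_square_inj[OF char2])
      then have "poly (shift_poly m) z = poly (shift_poly m) z'"
        using a0 by (simp add: G_def rescaled_L_0)
      then show "z = z'" using Z(3) z by (auto dest: inj_onD)
    qed
    then show "N \<le> card ((\<lambda>w. eval2 u w 0) ` (\<lambda>z. z\<^sup>2) ` Z)"
      using Z(2) by (simp add: image_image card_image)
  qed (use that in blast)

  \<comment> \<open>Bad values of \<open>\<alpha>\<close> give roots of \<open>P\<close>\<close>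
  have bad: "poly P (1 / \<alpha>) = 0" if \<alpha>: "\<alpha> \<noteq> 0" and Pi: "Pi_d d (L_op d \<alpha> f) = 0" for \<alpha> :: 'a
  proof -
    define b where "b = 1 / \<alpha>"
    have b: "b \<noteq> 0" using \<alpha> by (simp add: b_def)
    define g where "g = pcompose (Polynomial.smult (\<alpha> ^ m) (G b)) [:0, b\<^sup>2:]"
    have L: "L_op d \<alpha> f = g"
      unfolding g_def G_def b_def by (rule L_op_eq_rescaled_L[OF char2 md fdeg \<alpha>])
    have "coeff (G b) d \<noteq> 0"
      using b a1 unfolding dN h_G[symmetric] by (simp add: h_N a_def)
    then have gd: "coeff g d \<noteq> 0" using \<alpha> b by (simp add: g_def coeff_pcompose_linear)
    have "degree g \<le> d"
      using degree_pcompose_le[of "Polynomial.smult (\<alpha> ^ m) (G b)" "[:0, b\<^sup>2:]"]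
        degree_rescaled_L_le[OF md, of f b] \<alpha> b by (simp add: g_def G_def)
    then obtain ts i j where ts: "length ts = N" "pderiv g = Polynomial.smult (coeff g d) (\<Prod>t\<leftarrow>ts. [:t, 1:] ^ 2)"
      "i < N" "j < N" "i \<noteq> j" "poly g (ts ! i) = poly g (ts ! j)"
      using Pi_d_eq_0_imp[OF acf dN _ gd] Pi unfolding L by blast
    define us where "us = map ((*) (b\<^sup>2)) ts"
    have "pderiv (Polynomial.smult (\<alpha> ^ m) (G b)) =
        Polynomial.smult (coeff (Polynomial.smult (\<alpha> ^ m) (G b)) (2 * N + 1)) (\<Prod>t\<leftarrow>us. [:t, 1:] ^ 2)"
      unfolding us_def using ts(1,2) b dN by (intro critical_points_scale) (simp_all add: g_def)
    then have "Polynomial.smult (\<alpha> ^ m) (pderiv (G b)) =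
        Polynomial.smult (\<alpha> ^ m) (Polynomial.smult (coeff (G b) d) (\<Prod>t\<leftarrow>us. [:t, 1:] ^ 2))"
      using dN by (simp add: pderiv_smult)
    then have "pderiv (G b) = Polynomial.smult (coeff (G b) d) (\<Prod>t\<leftarrow>us. [:t, 1:] ^ 2)"
      by (rule smult_left_cancel[rotated]) (use \<alpha> in simp)
    then have odd: "odd_part (G b) = Polynomial.smult (coeff (G b) d) (\<Prod>t\<leftarrow>us. [:t\<^sup>2, 1:])"
      by (simp only: odd_part_factorization[OF char2])
    have len: "i < length us" "j < length us" using ts by (simp_all add: us_def)
    have "poly (G b) (us ! i) = poly (G b) (us ! j)"
      using ts \<alpha> by (simp add: us_def g_def poly_pcompose mult.commute)
    then have same: "eval2 u ((us ! i)\<^sup>2) b = eval2 u ((us ! j)\<^sup>2) b" by (simp add: eval_u)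
    have root: "eval2 H ((us ! k)\<^sup>2) b = 0" if "k < length us" for k
      using prod_list_root[OF char2 that, of "\<lambda>t. t\<^sup>2"] by (simp add: eval_H[OF b] odd)
    show ?thesis
    \<comment> \<open>Different indices may carry the same critical point. Its square is then a
      double root of \<open>H\<close>, and the second property of \<open>P\<close> applies.\<close>
    proof (cases "(us ! i)\<^sup>2 = (us ! j)\<^sup>2")
      case False
      then show ?thesis using P1[OF root root] len same unfolding b_def by blast
    next
      case True
      have "eval2 (pderiv H) ((us ! i)\<^sup>2) b = 0"
        using prod_list_double_root[OF char2 len ts(5), of "\<lambda>t. t\<^sup>2"] True
        by (simp add: eval_H[OF b] odd pderiv_smult)
      moreover have "poly (pderiv (G b)) (us ! i) = 0"
        using root[OF len(1)] b a1 by (simp add: eval_H[OF b] poly_odd_part_square[OF char2] a_def)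
      ultimately show ?thesis
        using P2[OF root[OF len(1)]] by (simp add: eval_u b_def)
    qed
  qed

  \<comment> \<open>Counting through the injection \<open>\<alpha>\<close> to
    \<open>1 / \<alpha>\<close>\<close>
  let ?S = "{\<alpha> :: 'a. \<alpha> \<noteq> 0 \<and> Pi_d d (L_op d \<alpha> f) = 0}"
  have fin: "finite {b. poly P b = 0}" using P(1) by (rule poly_roots_finite)
  have sub: "(\<lambda>\<alpha>. 1 / \<alpha>) ` ?S \<subseteq> {b. poly P b = 0}" using bad by auto
  have inj: "inj_on (\<lambda>\<alpha>. 1 / \<alpha>) ?S" by (auto simp: inj_on_def)
  have "finite ?S" using finite_imageD[OF finite_subset[OF sub fin] inj] .
  moreover have "card ?S \<le> (5 * d + 4) * e"
  proof -
    have "card ?S \<le> card {b. poly P b = 0}"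
      using card_inj_on_le[OF inj sub fin] .
    also have "\<dots> \<le> (4 * d + 2) * (N choose 2)"
      using card_poly_roots_bound[OF P(1)] P(2) by simp
    also have "\<dots> \<le> (5 * d + 4) * e" unfolding eN by (intro mult_right_mono) auto
    finally show ?thesis .
  qed
  ultimately show ?thesis by blast
qed

end
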